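(* Let $G$ be a finite simple graph. Then $G$ is connected (as a graph) if and only if $B(G)$ with the star topology is connected (as a topological space).
   Context: Graphs are finite and simple: $G=(V(G),E(G))$ with $E(G)$ a set of 2-element subsets of $V(G)$. A graph is connected if there is a path between any pair of its vertices. The bare representation $B(G)$ is the disjoint union $V(G)\sqcup E(G)$. The open star of $v\in V(G)$ is $S_G(v)=\{v\}\cup\{e\in E(G): e \text{ is incident to } v\}\subseteq B(G)$. The star topology on $B(G)$ is the topology generated by the sub-basis $\{S_G(v):v\in V(G)\}$. A topological space is connected if it cannot be written as the union of two disjoint non-empty open sets. *)

theory Defs
  imports "HOL-Analysis.Analysis"
begin

definition finite_simple_graph :: "'a set \<Rightarrow> 'a set set \<Rightarrow> bool" where
  "finite_simple_graph V E \<longleftrightarrow> finite V \<and> (\<forall>e\<in>E. e \<subseteq> V \<and> card e = 2)"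

definition is_path :: "'a set \<Rightarrow> 'a set set \<Rightarrow> 'a \<Rightarrow> 'a list \<Rightarrow> 'a \<Rightarrow> bool" where
  "is_path V E u p v \<longleftrightarrow> p \<noteq> [] \<and> hd p = u \<and> last p = v \<and> distinct p \<and> set p \<subseteq> V \<and>
     (\<forall>i. Suc i < length p \<longrightarrow> {p ! i, p ! Suc i} \<in> E)"

(* The graph without vertices counts as connected, in line with the empty space being
   connected under connected_space. *)
definition graph_connected :: "'a set \<Rightarrow> 'a set set \<Rightarrow> bool" where
  "graph_connected V E \<longleftrightarrow> (\<forall>u\<in>V. \<forall>v\<in>V. \<exists>p. is_path V E u p v)"

definition bare_rep :: "'a set \<Rightarrow> 'a set set \<Rightarrow> ('a + 'a set) set" where
  "bare_rep V E = V <+> E"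

definition open_star :: "'a set set \<Rightarrow> 'a \<Rightarrow> ('a + 'a set) set" where
  "open_star E v = {Inl v} \<union> Inr ` {e \<in> E. v \<in> e}"

(* topology_generated_by takes the union of the sub-basis as its carrier; topspace_star_topology
   below shows that this union is all of B(G). *)
definition star_topology :: "'a set \<Rightarrow> 'a set set \<Rightarrow> ('a + 'a set) topology" where
  "star_topology V E = topology_generated_by (open_star E ` V)"

lemma topspace_star_topology:
  assumes "finite_simple_graph V E"
  shows "topspace (star_topology V E) = bare_rep V E"
proof
  show "topspace (star_topology V E) \<subseteq> bare_rep V E"
    by (auto simp: star_topology_def bare_rep_def open_star_def topology_generated_by_topspace)
  have "\<exists>v\<in>V. v \<in> e" if "e \<in> E" for e
  proof -
    have "e \<subseteq> V" "e \<noteq> {}"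
      using assms that by (auto simp: finite_simple_graph_def)
    then show ?thesis by blast
  qed
  then show "bare_rep V E \<subseteq> topspace (star_topology V E)"
    by (fastforce simp: star_topology_def bare_rep_def open_star_def topology_generated_by_topspace)
qed

end

(* The star of v is the smallest open set containing v. Hence in a separation of B(G) an edge lies
   on the same side as each of its end points, so the side of a vertex is constant along paths.
   Conversely, the union of the stars of the vertices reachable from u and the union of the stars
   of the other vertices are disjoint open sets that cover B(G). *)
theory Submission
  imports Defs
begin

lemma openin_star_topology_open_star:
  "v \<in> V \<Longrightarrow> openin (star_topology V E) (open_star E v)"
  unfolding star_topology_def by (rule topology_generated_by_Basis) simp

text \<open>Induction over the generation of the topology: the only sub-basic set containing
  \<open>Inl v\<close> is the star of \<open>v\<close> itself, and the property survives binary
  intersections and arbitrary unions.\<close>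

lemma open_star_subset_openin:
  assumes "openin (star_topology V E) U" and "Inl v \<in> U"
  shows "open_star E v \<subseteq> U"
proof -
  have "generate_topology_on (open_star E ` V) U"
    using assms(1) by (simp add: star_topology_def openin_topology_generated_by)
  then show ?thesis
    using assms(2)
  proof (induction rule: generate_topology_on.induct)
    case (UN K)
    then show ?case by blast
  qed (auto simp: open_star_def)
qed

lemma separation_edge_iff:
  assumes "openin (star_topology V E) A" and "openin (star_topology V E) B"
    and "bare_rep V E \<subseteq> A \<union> B" and "A \<inter> B = {}"
    and "e \<in> E" and "v \<in> e" and "v \<in> V"
  shows "Inr e \<in> A \<longleftrightarrow> Inl v \<in> A"
proof -
  have "Inr e \<in> open_star E v"
    using assms(5,6) by (simp add: open_star_def)
  moreover have "Inl v \<in> A \<union> B"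
    using assms(3,7) by (auto simp: bare_rep_def)
  \<comment> \<open>Whichever of \<open>A\<close> and \<open>B\<close> contains \<open>Inl v\<close>
    contains its whole star and so \<open>Inr e\<close>; disjointness then gives both
    directions.\<close>
  ultimately show ?thesis
    using open_star_subset_openin[OF assms(1), of v] open_star_subset_openin[OF assms(2), of v]
      assms(4) by blast
qed

lemma separation_path:
  assumes "openin (star_topology V E) A" and "openin (star_topology V E) B"
    and "bare_rep V E \<subseteq> A \<union> B" and "A \<inter> B = {}"
    and "is_path V E u p v" and "Inl u \<in> A"
  shows "Inl v \<in> A"
proof -
  have p: "p \<noteq> []" "hd p = u" "last p = v" "set p \<subseteq> V"
    and step: "\<And>i. Suc i < length p \<Longrightarrow> {p ! i, p ! Suc i} \<in> E"
    using assms(5) by (auto simp: is_path_def)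
  have "Inl (p ! i) \<in> A" if "i < length p" for i
    using that
  proof (induction i)
    case 0
    then show ?case using p assms(6) by (simp add: hd_conv_nth)
  next
    case (Suc i)
    have "p ! i \<in> V" "p ! Suc i \<in> V"
      using Suc.prems p(4) by (auto simp: subset_iff)
    \<comment> \<open>The edge joining the two vertices lies on the side of each of them.\<close>
    then have "Inl (p ! i) \<in> A \<longleftrightarrow> Inl (p ! Suc i) \<in> A"
      using separation_edge_iff[OF assms(1-4) step[OF Suc.prems]] by blast
    then show ?case using Suc by simp
  qed
  then show ?thesis
    using p by (metis last_conv_nth diff_less length_greater_0_conv zero_less_one)
qed

text \<open>Supplies the end points of a path between the two sides. A point of \<open>A\<close>
  that is an edge can be traded for one of its end points, which exists because edges have two
  elements.\<close>

lemma separation_nonempty_has_vertex: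
  assumes "finite_simple_graph V E"
    and "openin (star_topology V E) A" and "openin (star_topology V E) B"
    and "bare_rep V E \<subseteq> A \<union> B" and "A \<inter> B = {}" and "A \<noteq> {}"
  obtains v where "v \<in> V" and "Inl v \<in> A"
proof -
  obtain x where x: "x \<in> A" using assms(6) by blast
  then have "x \<in> bare_rep V E"
    using openin_subset[OF assms(2)] topspace_star_topology[OF assms(1)] by blast
  then consider v where "v \<in> V" "x = Inl v" | e where "e \<in> E" "x = Inr e"
    by (auto simp: bare_rep_def)
  then show ?thesis
  proof cases
    case 1
    then show ?thesis using x that by blast
  next
    case 2
    have "e \<subseteq> V" "e \<noteq> {}"
      using assms(1) 2 by (auto simp: finite_simple_graph_def)
    then obtain v where "v \<in> e" "v \<in> V" by blast
    then show ?thesis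
      using separation_edge_iff[OF assms(2-5) 2(1)] x 2(2) that by blast
  qed
qed

lemma is_path_singleton: "v \<in> V \<Longrightarrow> is_path V E v [v] v"
  by (simp add: is_path_def)

text \<open>Paths must be \<open>distinct\<close>, so \<open>w\<close> can be appended only if it is
  new; otherwise the path is cut off at its visit to \<open>w\<close>.\<close>

lemma is_path_extend:
  assumes "is_path V E u p v" and "{v, w} \<in> E" and "w \<in> V"
  shows "\<exists>q. is_path V E u q w"
proof (cases "w \<in> set p")
  case True
  then obtain ys zs where eq: "p = ys @ w # zs" by (meson split_list)
  have "{(ys @ [w]) ! i, (ys @ [w]) ! Suc i} \<in> E" if "Suc i < length (ys @ [w])" for i
  proof -
    have "{p ! i, p ! Suc i} \<in> E"
      using assms(1) that eq by (simp add: is_path_def)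
    \<comment> \<open>The truncated list is a prefix of \<open>p\<close>, so its steps are steps of
      \<open>p\<close>.\<close>
    moreover have "p ! j = (ys @ [w]) ! j" if "j < length (ys @ [w])" for j
      using that eq by (auto simp: nth_append less_Suc_eq)
    ultimately show ?thesis using that by simp
  qed
  then have "is_path V E u (ys @ [w]) w"
    using assms(1) eq by (auto simp: is_path_def hd_append)
  then show ?thesis by blast
next
  case False
  have "{(p @ [w]) ! i, (p @ [w]) ! Suc i} \<in> E" if "Suc i < length (p @ [w])" for i
  proof (cases "Suc i < length p")
    case True
    then show ?thesis using assms(1) by (simp add: is_path_def nth_append)
  next
    case False
    \<comment> \<open>The remaining index is that of the added step, from the last vertex
      \<open>v\<close> of \<open>p\<close> to \<open>w\<close>.\<close>
    then have "length p = Suc i" using that by simp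
    then show ?thesis
      using assms(1,2) last_conv_nth[of p] by (simp add: is_path_def nth_append)
  qed
  then have "is_path V E u (p @ [w]) w"
    using assms(1,3) False by (auto simp: is_path_def)
  then show ?thesis by blast
qed

lemma graph_connected_imp_connected_space:
  assumes "finite_simple_graph V E" and "graph_connected V E"
  shows "connected_space (star_topology V E)"
  unfolding connected_space_def
proof (intro notI, elim exE conjE)
  fix A B
  assume "openin (star_topology V E) A" "openin (star_topology V E) B"
    and "topspace (star_topology V E) \<subseteq> A \<union> B" "A \<inter> B = {}" and ne: "A \<noteq> {}" "B \<noteq> {}"
  then have sep: "openin (star_topology V E) A" "openin (star_topology V E) B"
      "bare_rep V E \<subseteq> A \<union> B" "A \<inter> B = {}"
    by (simp_all add: topspace_star_topology[OF assms(1)])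
  \<comment> \<open>The separation with its sides exchanged, to find a vertex in \<open>B\<close> as
    well.\<close>
  then have sep': "bare_rep V E \<subseteq> B \<union> A" "B \<inter> A = {}" by blast+
  obtain u where u: "u \<in> V" "Inl u \<in> A"
    using separation_nonempty_has_vertex[OF assms(1) sep ne(1)] by blast
  obtain v where v: "v \<in> V" "Inl v \<in> B"
    using separation_nonempty_has_vertex[OF assms(1) sep(2,1) sep' ne(2)] by blast
  obtain p where "is_path V E u p v"
    using assms(2) u(1) v(1) by (auto simp: graph_connected_def)
  then have "Inl v \<in> A"
    using separation_path[OF sep] u(2) by blast
  then show False using v(2) sep(4) by blast
qed

lemma connected_space_imp_graph_connected:
  assumes "finite_simple_graph V E" and "connected_space (star_topology V E)"
  shows "graph_connected V E"
proof -
  have "\<exists>p. is_path V E u p v" if u: "u \<in> V" and v: "v \<in> V" for u v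
  proof (rule ccontr)
    assume nopath: "\<nexists>p. is_path V E u p v"
    \<comment> \<open>\<open>R\<close> is the vertex set of the component of
      \<open>u\<close>.\<close>
    define R where "R = {w \<in> V. \<exists>p. is_path V E u p w}"
    define A where "A = (\<Union>w\<in>R. open_star E w)"
    define B where "B = (\<Union>w\<in>V - R. open_star E w)"
    have open_AB: "openin (star_topology V E) A" "openin (star_topology V E) B"
      unfolding A_def B_def R_def by (auto intro!: openin_star_topology_open_star)
    have "topspace (star_topology V E) = (\<Union>w\<in>V. open_star E w)"
      by (simp add: star_topology_def topology_generated_by_topspace)
    then have cover: "topspace (star_topology V E) \<subseteq> A \<union> B"
      unfolding A_def B_def by blast
    \<comment> \<open>Stars of distinct vertices can meet only in an edge joining them. Such an edge
      would extend a path from \<open>u\<close> to \<open>w\<close> into one reaching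
      \<open>x\<close>, although \<open>x\<close> is outside \<open>R\<close>.\<close>
    have "open_star E w \<inter> open_star E x = {}" if w: "w \<in> R" and x: "x \<in> V - R" for w x
    proof -
      have neq: "w \<noteq> x" using w x by blast
      have "\<not> (w \<in> e \<and> x \<in> e)" if e: "e \<in> E" for e
      proof
        assume "w \<in> e \<and> x \<in> e"
        moreover have "card e = 2" using assms(1) e by (simp add: finite_simple_graph_def)
        ultimately have "e = {w, x}" using neq by (auto simp: card_2_iff)
        then have "x \<in> R" using w x e is_path_extend[of V E u _ w x] by (auto simp: R_def)
        then show False using x by blast
      qed
      then show ?thesis using neq by (auto simp: open_star_def)
    qed
    then have disj: "A \<inter> B = {}" unfolding A_def B_def by blast
    \<comment> \<open>The two sides are non-empty because \<open>u\<close> is reachable from itself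
      and \<open>v\<close> is not reachable from \<open>u\<close>.\<close>
    have "u \<in> R" using u is_path_singleton[OF u] by (auto simp: R_def)
    then have neA: "A \<noteq> {}" by (auto simp: A_def open_star_def)
    have "v \<in> V - R" using v nopath by (simp add: R_def)
    then have neB: "B \<noteq> {}" by (auto simp: B_def open_star_def)
    show False
      using assms(2) open_AB cover disj neA neB unfolding connected_space_def by blast
  qed
  then show ?thesis by (simp add: graph_connected_def)
qed

theorem theorem3p10:
  fixes V :: "'a set" and E :: "'a set set"
  assumes "finite_simple_graph V E"
  shows "graph_connected V E \<longleftrightarrow> connected_space (star_topology V E)"
  using graph_connected_imp_connected_space[OF assms] connected_space_imp_graph_connected[OF assms]
  by blast

end
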